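(* Let $n \geq 2$. If $C \subset \mathbf{R}^n$ is a smooth, non-degenerate curve, then $\dim_{\mathbf{F}}(C) = 2/n$.
   Context: A curve parameterized by a function $\gamma : I \to \mathbf{R}^n$ ($I \subset \mathbf{R}$ an interval) is non-degenerate if at each $t_0 \in I$ the vectors $\partial_t \gamma(t_0), \dots, \partial_t^n \gamma(t_0)$ are linearly independent. The Fourier dimension $\dim_{\mathbf{F}}(S)$ of a set $S \subset \mathbf{R}^d$ is the supremum of all $s \in (0,d]$ for which there exists a non-zero, finite, non-negative Borel measure $\mu$ supported on $S$ with $|\widehat{\mu}(\zeta)| \lesssim |\zeta|^{-s/2}$ uniformly for all non-zero $\zeta \in \mathbf{R}^d$ (and it is $0$ if there is no such $s$). *)

theory Defs
  imports "HOL-Analysis.Analysis"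
begin

section \<open>Smooth non-degenerate curves\<close>

text \<open>
  The derivatives are taken within the parameter set, so that they are one-sided at those
  endpoints that belong to an interval. They are meaningful on intervals with more than one point.
\<close>

primrec nth_vector_derivative ::
    "nat \<Rightarrow> real set \<Rightarrow> (real \<Rightarrow> 'a::real_normed_vector) \<Rightarrow> real \<Rightarrow> 'a" where
  "nth_vector_derivative 0 I \<gamma> = \<gamma>"
| "nth_vector_derivative (Suc k) I \<gamma> =
     (\<lambda>t. vector_derivative (nth_vector_derivative k I \<gamma>) (at t within I))"

definition smooth_on :: "real set \<Rightarrow> (real \<Rightarrow> 'a::real_normed_vector) \<Rightarrow> bool" where
  "smooth_on I \<gamma> \<longleftrightarrow>
     (\<forall>k. \<forall>t\<in>I. nth_vector_derivative k I \<gamma> differentiable (at t within I))"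

text \<open>
  Injectivity is needed because \<^const>\<open>independent\<close> speaks about sets, whereas the derivatives
  have to be linearly independent as a family.
\<close>

definition nondegenerate_on :: "real set \<Rightarrow> (real \<Rightarrow> 'a::euclidean_space) \<Rightarrow> bool" where
  "nondegenerate_on I \<gamma> \<longleftrightarrow>
     (\<forall>t\<in>I. inj_on (\<lambda>k. nth_vector_derivative k I \<gamma> t) {1..DIM('a)} \<and>
             independent ((\<lambda>k. nth_vector_derivative k I \<gamma> t) ` {1..DIM('a)}))"

section \<open>Fourier dimension\<close>

definition fourier_transform :: "'a::euclidean_space measure \<Rightarrow> 'a \<Rightarrow> complex" where
  "fourier_transform \<mu> \<zeta> = (LINT x|\<mu>. cis (- 2 * pi * (x \<bullet> \<zeta>)))"

text \<open>
  The closed support of a Borel measure. A measure is supported on \<open>S\<close> if its closed support is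
  contained in \<open>S\<close>; this is stronger than vanishing outside \<open>S\<close> unless \<open>S\<close> is closed.
\<close>

definition measure_support :: "'a::topological_space measure \<Rightarrow> 'a set" where
  "measure_support \<mu> = {x. \<forall>U. open U \<and> x \<in> U \<longrightarrow> emeasure \<mu> U > 0}"

definition fourier_decay_exponents :: "'a::euclidean_space set \<Rightarrow> real set" where
  "fourier_decay_exponents S =
     {s. 0 < s \<and> s \<le> real DIM('a) \<and>
         (\<exists>\<mu> :: 'a measure. sets \<mu> = sets borel \<and> finite_measure \<mu> \<and>
             emeasure \<mu> UNIV \<noteq> 0 \<and> measure_support \<mu> \<subseteq> S \<and>
             (\<exists>K. \<forall>\<zeta>. \<zeta> \<noteq> 0 \<longrightarrow>
                norm (fourier_transform \<mu> \<zeta>) \<le> K * norm \<zeta> powr (- s / 2)))}"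

definition fourier_dim :: "'a::euclidean_space set \<Rightarrow> real" where
  "fourier_dim S =
     (if fourier_decay_exponents S = {} then 0 else Sup (fourier_decay_exponents S))"

end

theory Submission
  imports Defs
begin

text \<open>
  Upper bound: if \<open>\<mu>\<close> has Fourier decay of order \<open>\<sigma> = s / 2\<close>, then testing \<open>\<mu>\<close> against a Fejer kernel
  shows that a slab of width \<open>\<epsilon>\<close> has mass \<open>O(\<epsilon> powr \<sigma>)\<close>. By Taylor's formula in a direction orthogonal
  to the first \<open>n - 1\<close> derivatives of the curve, a compact arc is covered by \<open>O(m)\<close> slabs of width
  \<open>O(1 / m ^ n)\<close>, so it has mass \<open>O(m powr (1 - n * \<sigma>))\<close>, which tends to \<open>0\<close> if \<open>s > 2 / n\<close>.

  Lower bound: take the image of Lebesgue measure on a short interval. By non-degeneracy, for every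
  frequency \<open>\<zeta>\<close> one of the first \<open>n\<close> derivatives of the phase is comparable to \<open>norm \<zeta>\<close> on the whole
  interval, and van der Corput's lemma applies.
\<close>

section \<open>Fourier decay and the mass of thin slabs\<close>

lemma nth_vector_derivative_has_vector_derivative:
  assumes "smooth_on I \<gamma>" "t \<in> I"
  shows "(nth_vector_derivative k I \<gamma> has_vector_derivative nth_vector_derivative (Suc k) I \<gamma> t)
           (at t within I)"
  using assms by (simp add: smooth_on_def vector_derivative_works)

text \<open>A discrete comparison with the integral of \<open>x powr (- \<sigma>)\<close>: by the
  mean value theorem each new term is at most the increment of
  \<open>x powr (1 - \<sigma>) / (1 - \<sigma>)\<close>, and the increments telescope.\<close>

lemma sum_powr_neg_le:
  fixes \<sigma> :: real
  assumes "0 < \<sigma>" "\<sigma> < 1" "N \<ge> 1"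
  shows "(\<Sum>d=1..N. real d powr (- \<sigma>)) \<le> real N powr (1 - \<sigma>) / (1 - \<sigma>)"
  using \<open>N \<ge> 1\<close>
proof (induction N rule: dec_induct)
  case base
  show ?case using assms by simp
next
  case (step N)
  have "\<exists>z. real N < z \<and> z < real (Suc N) \<and>
      real (Suc N) powr (1 - \<sigma>) - real N powr (1 - \<sigma>) =
        (real (Suc N) - real N) * ((1 - \<sigma>) * z powr (1 - \<sigma> - 1))"
    using step by (intro MVT2) (auto intro!: derivative_eq_intros)
  then obtain z where z: "real N < z" "z < real (Suc N)"
    "real (Suc N) powr (1 - \<sigma>) - real N powr (1 - \<sigma>) = (1 - \<sigma>) * z powr (- \<sigma>)"
    by auto
  have "real (Suc N) powr (- \<sigma>) \<le> z powr (- \<sigma>)"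
    using z assms by (intro powr_mono2') auto
  then have "(1 - \<sigma>) * real (Suc N) powr (- \<sigma>) \<le>
      real (Suc N) powr (1 - \<sigma>) - real N powr (1 - \<sigma>)"
    using z(3) assms by simp
  then have "real (Suc N) powr (- \<sigma>) \<le>
      real (Suc N) powr (1 - \<sigma>) / (1 - \<sigma>) - real N powr (1 - \<sigma>) / (1 - \<sigma>)"
    using assms by (simp add: diff_divide_distrib[symmetric] pos_le_divide_eq mult.commute)
  then show ?case using step by (simp del: of_nat_Suc)
qed

lemma norm_fourier_transform_le:
  assumes "finite_measure \<mu>"
  shows "norm (fourier_transform \<mu> \<zeta>) \<le> measure \<mu> (space \<mu>)"
proof -
  interpret finite_measure \<mu> by fact
  have "norm (fourier_transform \<mu> \<zeta>) \<le> (LINT x|\<mu>. norm (cis (- 2 * pi * (x \<bullet> \<zeta>))))"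
    unfolding fourier_transform_def by (rule integral_norm_bound)
  then show ?thesis by simp
qed

text \<open>
  The Fejer kernel \<open>\<bar>\<Sum>j<N. cis (- 2 * pi * j * y)\<bar>\<^sup>2\<close> is nonnegative and at least \<open>N\<^sup>2 / 4\<close> for
  \<open>\<bar>y\<bar> \<le> 1 / (8 * N)\<close>, while its integral is a finite sum of values of the Fourier transform.
\<close>

lemma measure_slab_le:
  fixes \<mu> :: "'a::euclidean_space measure" and \<sigma> :: real
  assumes sets: "sets \<mu> = sets borel" and "finite_measure \<mu>"
    and "0 < \<sigma>" "\<sigma> < 1" "K \<ge> 0"
    and decay: "\<And>\<zeta>. \<zeta> \<noteq> 0 \<Longrightarrow> norm (fourier_transform \<mu> \<zeta>) \<le> K * norm \<zeta> powr (- \<sigma>)"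
    and "e \<noteq> 0" "N \<ge> 1"
  shows "measure \<mu> {x. \<bar>(x - p) \<bullet> e\<bar> \<le> 1 / (8 * real N)} \<le>
    4 * (measure \<mu> UNIV + 2 * K * norm e powr (- \<sigma>) / (1 - \<sigma>)) * real N powr (- \<sigma>)"
proof -
  interpret finite_measure \<mu> by fact
  have space: "space \<mu> = UNIV" using sets sets_eq_imp_space_eq by fastforce
  define m where "m = measure \<mu> UNIV"
  define A where "A = K * norm e powr (- \<sigma>)"
  \<comment> \<open>\<open>g d\<close> majorizes the Fourier transform at
    \<open>(real j - real k) *\<^sub>R e\<close> when \<open>j\<close> and \<open>k\<close> are at
    distance \<open>d\<close>. The decay hypothesis is silent at frequency 0, where the total mass
    serves instead.\<close>
  define g where "g d = (if d = 0 then m else A * real d powr (- \<sigma>))" for d :: nat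
  define B where "B = 2 * K * norm e powr (- \<sigma>) / (1 - \<sigma>)"
  have "A \<ge> 0" "m \<ge> 0" using \<open>K \<ge> 0\<close> by (auto simp: A_def m_def)
  have gnn: "g d \<ge> 0" for d using \<open>A \<ge> 0\<close> \<open>m \<ge> 0\<close> by (simp add: g_def)
  define S where "S x = (\<Sum>j<N. cis (- 2 * pi * (real j * ((x - p) \<bullet> e))))" for x
  have ft: "norm (fourier_transform \<mu> ((real j - real k) *\<^sub>R e)) \<le> g (nat \<bar>int j - int k\<bar>)" for j k
  proof (cases "j = k")
    case True
    then show ?thesis
      using norm_fourier_transform_le[OF assms(2), of 0] by (simp add: g_def m_def space)
  next
    case False
    have "norm (fourier_transform \<mu> ((real j - real k) *\<^sub>R e)) \<le>
        K * norm ((real j - real k) *\<^sub>R e) powr (- \<sigma>)"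
      using False \<open>e \<noteq> 0\<close> by (intro decay) auto
    also have "\<dots> = A * \<bar>real j - real k\<bar> powr (- \<sigma>)"
      by (simp add: A_def powr_mult)
    also have "\<bar>real j - real k\<bar> = real (nat \<bar>int j - int k\<bar>)" by simp
    finally show ?thesis using False by (simp add: g_def)
  qed
  \<comment> \<open>In row \<open>j\<close> the distance 0 occurs once and every other distance at
    most twice. The term \<open>m\<close> from the diagonal is absorbed because
    \<open>real N powr (1 - \<sigma>)\<close> is at least 1.\<close>
  have row: "(\<Sum>k<N. g (nat \<bar>int j - int k\<bar>)) \<le> (m + B) * real N powr (1 - \<sigma>)" if "j < N" for j
  proof -
    have *: "(\<Sum>d=1..N. g d) \<le> A * (real N powr (1 - \<sigma>) / (1 - \<sigma>))"
      using mult_left_mono[OF sum_powr_neg_le[OF assms(3,4,8)] \<open>A \<ge> 0\<close>]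
      by (simp add: g_def sum_distrib_left)
    have g0: "g 0 = m" by (simp add: g_def)
    have split: "{..<N} = insert j ({..<j} \<union> {j<..<N})" using that by auto
    have "(\<Sum>k<N. g (nat \<bar>int j - int k\<bar>)) =
       (\<Sum>k<j. g (nat \<bar>int j - int k\<bar>)) + m + (\<Sum>k\<in>{j<..<N}. g (nat \<bar>int j - int k\<bar>))"
      unfolding split by (subst sum.insert, simp, simp, subst sum.union_disjoint) (auto simp: g0)
    also have "(\<Sum>k<j. g (nat \<bar>int j - int k\<bar>)) = (\<Sum>d=1..j. g d)"
      by (rule sum.reindex_bij_witness[where i="\<lambda>d. j - d" and j="\<lambda>k. j - k"])
         (auto intro!: arg_cong[where f=g])
    also have "\<dots> \<le> (\<Sum>d=1..N. g d)" using that by (intro sum_mono2) (auto simp: gnn)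
    also have "(\<Sum>k\<in>{j<..<N}. g (nat \<bar>int j - int k\<bar>)) = (\<Sum>d\<in>{1..<N-j}. g d)"
      by (rule sum.reindex_bij_witness[where i="\<lambda>d. j + d" and j="\<lambda>k. k - j"])
         (auto intro!: arg_cong[where f=g])
    also have "\<dots> \<le> (\<Sum>d=1..N. g d)" by (intro sum_mono2) (auto simp: gnn)
    finally have "(\<Sum>k<N. g (nat \<bar>int j - int k\<bar>)) \<le> m + 2 * (\<Sum>d=1..N. g d)" by simp
    also have "\<dots> \<le> m * real N powr (1 - \<sigma>) + 2 * (A * (real N powr (1 - \<sigma>) / (1 - \<sigma>)))"
    proof -
      have "1 \<le> real N powr (1 - \<sigma>)" using assms by (intro ge_one_powr_ge_zero) auto
      then have "m * 1 \<le> m * real N powr (1 - \<sigma>)" using \<open>m \<ge> 0\<close> by (intro mult_left_mono)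
      then show ?thesis using * by simp
    qed
    also have "\<dots> = (m + B) * real N powr (1 - \<sigma>)"
      by (simp add: A_def B_def algebra_simps)
    finally show ?thesis .
  qed
  have meas[measurable]: "(\<lambda>x. cis (f x)) \<in> borel_measurable \<mu>"
    if "continuous_on UNIV f" for f :: "'a \<Rightarrow> real"
    unfolding measurable_cong_sets[OF sets refl] cis.ctr complex_eq_iff
    using that by (intro borel_measurable_continuous_onI) (auto simp: cis_conv_exp intro!: continuous_intros)
  have integ: "integrable \<mu> (\<lambda>x. cis (f x))" if "continuous_on UNIV f" for f :: "'a \<Rightarrow> real"
    by (rule integrable_const_bound[where B=1]) (auto simp: meas[OF that])
  \<comment> \<open>Multiplying out the squared modulus produces only the frequencies
    \<open>(real j - real k) *\<^sub>R e\<close>. The base point \<open>p\<close> contributes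
    unimodular factors, which disappear in norm.\<close>
  have sq: "complex_of_real ((norm (S x))\<^sup>2) =
     (\<Sum>j<N. \<Sum>k<N. cis (2 * pi * (p \<bullet> ((real j - real k) *\<^sub>R e))) *
        cis (- 2 * pi * (x \<bullet> ((real j - real k) *\<^sub>R e))))" for x
    unfolding complex_norm_square S_def cnj_sum sum_product cis_cnj cis_mult
    by (intro sum.cong refl arg_cong[where f=cis]) (simp add: algebra_simps)
  have int: "integrable \<mu> (\<lambda>x. complex_of_real ((norm (S x))\<^sup>2))"
    unfolding sq by (intro Bochner_Integration.integrable_sum integrable_mult_right integ continuous_intros)
  then have int': "integrable \<mu> (\<lambda>x. (norm (S x))\<^sup>2)"
    using integrable_Re by fastforce
  have "complex_of_real (LINT x|\<mu>. (norm (S x))\<^sup>2) = (LINT x|\<mu>. complex_of_real ((norm (S x))\<^sup>2))"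
    by (rule integral_complex_of_real[symmetric])
  also have "\<dots> = (\<Sum>j<N. \<Sum>k<N. cis (2 * pi * (p \<bullet> ((real j - real k) *\<^sub>R e))) *
        fourier_transform \<mu> ((real j - real k) *\<^sub>R e))"
    unfolding sq fourier_transform_def
    by (subst Bochner_Integration.integral_sum integral_mult_right_zero | 
        intro Bochner_Integration.integrable_sum integrable_mult_right integ continuous_intros sum.cong refl)+
  finally have "\<bar>LINT x|\<mu>. (norm (S x))\<^sup>2\<bar> = norm (\<Sum>j<N. \<Sum>k<N. cis (2 * pi * (p \<bullet> ((real j - real k) *\<^sub>R e))) *
        fourier_transform \<mu> ((real j - real k) *\<^sub>R e))"
    by (metis norm_of_real)
  also have "\<dots> \<le> (\<Sum>j<N. \<Sum>k<N. g (nat \<bar>int j - int k\<bar>))"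
    by (intro sum_norm_le) (simp only: norm_mult norm_cis mult_1 ft)
  also have "\<dots> \<le> (\<Sum>j<N. (m + B) * real N powr (1 - \<sigma>))" by (intro sum_mono row) auto
  also have "\<dots> = (m + B) * (real N * real N powr (1 - \<sigma>))" by simp
  finally have up: "(LINT x|\<mu>. (norm (S x))\<^sup>2) \<le> (m + B) * (real N * real N powr (1 - \<sigma>))" by simp
  define T where "T = {x. \<bar>(x - p) \<bullet> e\<bar> \<le> 1 / (8 * real N)}"
  have "closed T" unfolding T_def by (intro closed_Collect_le continuous_intros)
  then have T: "T \<in> sets \<mu>" using sets by simp
  \<comment> \<open>On the slab all phases are at most \<open>pi / 4\<close> in absolute value,
    hence below \<open>pi / 3\<close>, so each of the \<open>N\<close> terms has real part at least
    1/2 and nothing cancels.\<close>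
  have low: "real N / 2 \<le> norm (S x)" if "x \<in> T" for x
  proof -
    have "1/2 \<le> cos (- 2 * pi * (real j * ((x - p) \<bullet> e)))" if "j < N" for j
    proof -
      have "real j * \<bar>(x - p) \<bullet> e\<bar> \<le> real N * (1 / (8 * real N))"
        using \<open>x \<in> T\<close> that by (intro mult_mono) (auto simp: T_def)
      then have "real j * \<bar>(x - p) \<bullet> e\<bar> \<le> 1/8" using \<open>N \<ge> 1\<close> by simp
      then have "2 * pi * (real j * \<bar>(x - p) \<bullet> e\<bar>) \<le> 2 * pi * (1/6)"
        by (intro mult_left_mono) auto
      then have "cos (pi / 3) \<le> cos (2 * pi * (real j * \<bar>(x - p) \<bullet> e\<bar>))"
        by (intro cos_monotone_0_pi_le) auto
      also have "2 * pi * (real j * \<bar>(x - p) \<bullet> e\<bar>) = \<bar>- 2 * pi * (real j * ((x - p) \<bullet> e))\<bar>"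
        by (simp add: abs_mult)
      finally show ?thesis unfolding cos_abs_real by (simp add: cos_60)
    qed
    then have "(\<Sum>j<N. 1/2) \<le> (\<Sum>j<N. cos (- 2 * pi * (real j * ((x - p) \<bullet> e))))"
      by (intro sum_mono) auto
    also have "\<dots> = Re (S x)" by (simp add: S_def)
    also have "\<dots> \<le> norm (S x)" by (rule complex_Re_le_cmod)
    finally show ?thesis by simp
  qed
  \<comment> \<open>The slab alone contributes at least \<open>N\<^sup>2 / 4\<close> times its mass
    to the integral of the kernel, whereas the double sum is of order
    \<open>N powr (2 - \<sigma>)\<close>.\<close>
  have "(real N / 2)\<^sup>2 * measure \<mu> T = (LINT x|\<mu>. (real N / 2)\<^sup>2 * indicator T x)"
    using T by simp
  also have "\<dots> \<le> (LINT x|\<mu>. (norm (S x))\<^sup>2)"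
    using T low by (intro integral_mono int' integrable_mult_right integrable_real_indicator)
      (auto simp: indicator_def emeasure_eq_measure intro!: power_mono)
  also note up
  finally have "(real N)\<^sup>2 * measure \<mu> T \<le> 4 * (m + B) * (real N * real N powr (1 - \<sigma>))"
    by (simp add: power_divide algebra_simps)
  also have "real N powr (1 - \<sigma>) = real N * real N powr (- \<sigma>)"
    using \<open>N \<ge> 1\<close> by (simp add: powr_diff powr_minus field_simps)
  finally have "(real N)\<^sup>2 * measure \<mu> T \<le> (real N)\<^sup>2 * (4 * (m + B) * real N powr (- \<sigma>))"
    by (simp add: power2_eq_square algebra_simps)
  then have "measure \<mu> T \<le> 4 * (m + B) * real N powr (- \<sigma>)"
    using \<open>N \<ge> 1\<close> by (simp add: mult_le_cancel_left)
  then show ?thesis by (simp add: T_def m_def B_def)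
qed

section \<open>Covering a compact arc by slabs\<close>

text \<open>The Taylor coefficients of orders 1 to \<open>n - 1\<close> at \<open>a\<close> vanish,
  so only the remainder of order \<open>n\<close> is left. The induction hypothesis, applied to the
  shifted family \<open>\<lambda>k. g (Suc k)\<close>, bounds the derivative \<open>g 1\<close>; the
  mean value inequality then gains one power of \<open>t - a\<close>. The factor
  \<open>1 / fact n\<close> is given up.\<close>

lemma Taylor_bound_flat:
  fixes g :: "nat \<Rightarrow> real \<Rightarrow> real"
  assumes "n \<ge> 1" "a \<le> t" "t \<le> b"
    and "\<And>k x. k < n \<Longrightarrow> x \<in> {a..b} \<Longrightarrow> (g k has_real_derivative g (Suc k) x) (at x within {a..b})"
    and "\<And>k. 1 \<le> k \<Longrightarrow> k < n \<Longrightarrow> g k a = 0"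
    and "\<And>x. x \<in> {a..b} \<Longrightarrow> \<bar>g n x\<bar> \<le> M"
  shows "\<bar>g 0 t - g 0 a\<bar> \<le> M * (t - a) ^ n"
  using assms
proof (induction n arbitrary: g t rule: dec_induct)
  case (base g t)
  have "norm (g 0 t - g 0 a) \<le> M * norm (t - a)"
    by (rule field_differentiable_bound[of "{a..b}" _ "g 1"]) (use base in auto)
  then show ?case using base by simp
next
  case (step n g t)
  have ih: "\<bar>g 1 x\<bar> \<le> M * (x - a) ^ n" if "a \<le> x" "x \<le> b" for x
    using step.IH[of x "\<lambda>k. g (Suc k)"] step.prems step.hyps that by simp
  have "M \<ge> 0" using step.prems(5)[of a] step.prems(1,2) by force
  have "norm (g 0 t - g 0 a) \<le> (M * (t - a) ^ n) * norm (t - a)"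
  proof (rule field_differentiable_bound[of "{a..t}" _ "g 1"])
    fix x assume x: "x \<in> {a..t}"
    then show "(g 0 has_field_derivative g 1 x) (at x within {a..t})"
      using step.prems(3)[of 0 x] step.prems(2) by (auto intro: has_field_derivative_subset)
    have "\<bar>g 1 x\<bar> \<le> M * (x - a) ^ n" using ih x step.prems by auto
    also have "\<dots> \<le> M * (t - a) ^ n" using x \<open>M \<ge> 0\<close> by (intro mult_left_mono power_mono) auto
    finally show "norm (g 1 x) \<le> M * (t - a) ^ n" by simp
  qed (use step in auto)
  then show ?case using step.prems by (simp add: ac_simps)
qed

text \<open>Fewer vectors than the dimension span a proper subspace. The length \<open>h\<close> is
  left free because it sets the width of the slab in the direction \<open>e\<close>.\<close>

lemma exists_orthogonal_vector:
  fixes v :: "nat \<Rightarrow> 'a::euclidean_space"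
  assumes "h > 0"
  obtains e where "norm e = h" "\<And>k. 1 \<le> k \<Longrightarrow> k < DIM('a) \<Longrightarrow> v k \<bullet> e = 0"
proof -
  have "dim (v ` {1..<DIM('a)}) \<le> card (v ` {1..<DIM('a)})"
    by (intro dim_le_card span_superset) auto
  also have "\<dots> \<le> card {1..<DIM('a)}" by (intro card_image_le) auto
  also have "\<dots> < DIM('a)" by simp
  finally obtain x where x: "x \<noteq> 0" "\<And>y. y \<in> span (v ` {1..<DIM('a)}) \<Longrightarrow> orthogonal x y"
    using orthogonal_to_subspace_exists by blast
  show thesis
  proof (rule that[of "(h / norm x) *\<^sub>R x"])
    show "norm ((h / norm x) *\<^sub>R x) = h" using x(1) assms by simp
    fix k assume "1 \<le> k" "k < DIM('a)"
    then have "orthogonal x (v k)" by (intro x(2) span_base) auto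
    then show "v k \<bullet> ((h / norm x) *\<^sub>R x) = 0" by (simp add: orthogonal_def inner_commute)
  qed
qed

lemma emeasure_arc_eq_0:
  fixes \<mu> :: "'a::euclidean_space measure" and \<sigma> :: real and D :: "nat \<Rightarrow> real \<Rightarrow> 'a"
  assumes sets: "sets \<mu> = sets borel" and fin: "finite_measure \<mu>"
    and \<sigma>: "0 < \<sigma>" "\<sigma> < 1" "1 < DIM('a) * \<sigma>" and "K \<ge> 0"
    and decay: "\<And>\<zeta>. \<zeta> \<noteq> 0 \<Longrightarrow> norm (fourier_transform \<mu> \<zeta>) \<le> K * norm \<zeta> powr (- \<sigma>)"
    and D: "\<And>k t. t \<in> {a..b} \<Longrightarrow> (D k has_vector_derivative D (Suc k) t) (at t within {a..b})"
  shows "emeasure \<mu> (D 0 ` {a..b}) = 0"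
proof (cases "a \<le> b")
  case True
  interpret finite_measure \<mu> by fact
  let ?n = "DIM('a)"
  have cont: "continuous_on {a..b} (D k)" for k
    using D by (rule continuous_on_vector_derivative)
  have compact: "compact (D 0 ` {a..b})" by (intro compact_continuous_image cont) auto
  have "bounded (D ?n ` {a..b})"
    by (intro compact_imp_bounded compact_continuous_image cont) auto
  then obtain M where "M > 0" and M: "\<And>t. t \<in> {a..b} \<Longrightarrow> norm (D ?n t) \<le> M"
    unfolding bounded_pos by blast
  \<comment> \<open>With this \<open>h\<close>, the remainder bound
    \<open>M * h * ((b - a + 1) / m) ^ DIM('a)\<close> equals \<open>1 / (8 * m ^ DIM('a))\<close>,
    which is the slab condition for \<open>N = m ^ DIM('a)\<close>. The summand 1 keeps the
    denominator positive when \<open>a = b\<close>.\<close>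
  define h where "h = 1 / (8 * M * (b - a + 1) ^ ?n)"
  have "h > 0" using True \<open>M > 0\<close> by (simp add: h_def)
  \<comment> \<open>The constant of the slab estimate for \<open>norm e = h\<close>; it is the same
    for every number \<open>m\<close> of subdivisions.\<close>
  define c where "c = 4 * (measure \<mu> UNIV + 2 * K * h powr (- \<sigma>) / (1 - \<sigma>))"
  have "c \<ge> 0" using \<open>K \<ge> 0\<close> \<sigma> by (auto simp: c_def)
  have bound: "measure \<mu> (D 0 ` {a..b}) \<le> 2 * c * real m powr (1 - ?n * \<sigma>)" if "m \<ge> 1" for m :: nat
  proof -
    define p where "p i = a + real i * ((b - a) / real m)" for i
    have p: "p i \<in> {a..b}" if "i \<le> m" for i
    proof -
      have "real i * ((b - a) / real m) \<le> real m * ((b - a) / real m)"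
        using that True by (intro mult_right_mono) auto
      then show ?thesis using \<open>m \<ge> 1\<close> True by (auto simp: p_def)
    qed
    have "\<exists>e. norm e = h \<and> (\<forall>k. 1 \<le> k \<longrightarrow> k < ?n \<longrightarrow> D k (p i) \<bullet> e = 0)" for i
      using exists_orthogonal_vector[OF \<open>h > 0\<close>, of "\<lambda>k. D k (p i)"] by blast
    then have "\<exists>e. \<forall>i. norm (e i) = h \<and> (\<forall>k. 1 \<le> k \<longrightarrow> k < ?n \<longrightarrow> D k (p i) \<bullet> e i = 0)"
      by (intro choice allI)
    then obtain e where e: "\<And>i. norm (e i) = h"
      "\<And>i k. 1 \<le> k \<Longrightarrow> k < ?n \<Longrightarrow> D k (p i) \<bullet> e i = 0" by blast
    define T where "T i = {x. \<bar>(x - D 0 (p i)) \<bullet> e i\<bar> \<le> 1 / (8 * real (m ^ ?n))}" for i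
    have "closed (T i)" for i unfolding T_def by (intro closed_Collect_le continuous_intros)
    then have T[measurable]: "T i \<in> sets \<mu>" for i using sets by simp
    have "D 0 ` {a..b} \<subseteq> (\<Union>i\<in>{..m}. T i)"
    proof
      fix x assume "x \<in> D 0 ` {a..b}"
      then obtain t where t: "t \<in> {a..b}" "x = D 0 t" by blast
      have "\<exists>i\<le>m. p i \<le> t \<and> t - p i \<le> (b - a + 1) / real m"
      proof (cases "a < b")
        case False
        then have "t = a" "a = b" using t by auto
        then show ?thesis by (intro exI[of _ 0]) (auto simp: p_def)
      next
        case True
        \<comment> \<open>The index of the last subdivision point at or before \<open>t\<close>. For
          \<open>t = b\<close> it is \<open>m\<close>, so there are \<open>m + 1\<close> slabs
          rather than \<open>m\<close>; the factor 2 in the bound pays for this.\<close>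
        define i where "i = nat \<lfloor>(t - a) / ((b - a) / real m)\<rfloor>"
        have step: "0 < (b - a) / real m" using True \<open>m \<ge> 1\<close> by simp
        have "(t - a) / ((b - a) / real m) \<ge> 0" using t True by auto
        then have i: "real i \<le> (t - a) / ((b - a) / real m)" "(t - a) / ((b - a) / real m) < real i + 1"
          unfolding i_def by linarith+
        then have i': "real i * ((b - a) / real m) \<le> t - a" "t - a < (real i + 1) * ((b - a) / real m)"
          by (simp_all only: pos_le_divide_eq[OF step] pos_divide_less_eq[OF step])
        have "real i * ((b - a) / real m) \<le> real m * ((b - a) / real m)"
          using i'(1) t \<open>m \<ge> 1\<close> by simp
        then have "i \<le> m"
          using True \<open>m \<ge> 1\<close> by (subst (asm) mult_le_cancel_right) (auto simp: divide_simps)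
        have "(b - a) / real m \<le> (b - a + 1) / real m" by (intro divide_right_mono) auto
        then have "p i \<le> t" "t - p i \<le> (b - a + 1) / real m"
          using i' unfolding p_def distrib_right by linarith+
        with \<open>i \<le> m\<close> show ?thesis by blast
      qed
      then obtain i where i: "i \<le> m" "p i \<le> t" "t - p i \<le> (b - a + 1) / real m" by blast
      have "\<bar>D 0 t \<bullet> e i - D 0 (p i) \<bullet> e i\<bar> \<le> (M * h) * (t - p i) ^ ?n"
      proof (rule Taylor_bound_flat[where g="\<lambda>k x. D k x \<bullet> e i" and b=b])
        fix k y assume y: "y \<in> {p i..b}"
        have "(D k has_vector_derivative D (Suc k) y) (at y within {p i..b})"
          by (rule has_vector_derivative_within_subset[OF D]) (use y p[OF i(1)] in auto)
        then show "((\<lambda>x. D k x \<bullet> e i) has_real_derivative D (Suc k) y \<bullet> e i) (at y within {p i..b})"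
          unfolding has_real_derivative_iff_has_vector_derivative
          by (rule bounded_linear.has_vector_derivative[OF bounded_linear_inner_left])
      next
        fix y assume y: "y \<in> {p i..b}"
        have "\<bar>D ?n y \<bullet> e i\<bar> \<le> norm (D ?n y) * norm (e i)" by (rule Cauchy_Schwarz_ineq2)
        also have "\<dots> \<le> M * h" using M[of y] y p[OF i(1)] e(1) \<open>h > 0\<close> by (auto intro!: mult_right_mono)
        finally show "\<bar>D ?n y \<bullet> e i\<bar> \<le> M * h" .
      qed (use i t e in \<open>auto simp: Suc_le_eq\<close>)
      also have "\<dots> \<le> (M * h) * ((b - a + 1) / real m) ^ ?n"
        using i \<open>M > 0\<close> \<open>h > 0\<close> by (intro mult_left_mono power_mono) auto
      also have "\<dots> = 1 / (8 * real (m ^ ?n))"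
        using \<open>M > 0\<close> True by (simp add: h_def power_divide field_simps)
      finally show "x \<in> (\<Union>i\<in>{..m}. T i)"
        using i t by (auto simp: T_def inner_diff_left)
    qed
    then have "measure \<mu> (D 0 ` {a..b}) \<le> measure \<mu> (\<Union>i\<in>{..m}. T i)"
      by (intro finite_measure_mono) auto
    also have "\<dots> \<le> (\<Sum>i\<le>m. measure \<mu> (T i))"
      by (intro finite_measure_subadditive_finite) auto
    also have "\<dots> \<le> (\<Sum>i\<le>m. c * real (m ^ ?n) powr (- \<sigma>))"
    proof (intro sum_mono)
      fix i
      have "e i \<noteq> 0" using e(1)[of i] \<open>h > 0\<close> by auto
      then show "measure \<mu> (T i) \<le> c * real (m ^ ?n) powr (- \<sigma>)"
        using measure_slab_le[OF sets fin \<sigma>(1,2) \<open>K \<ge> 0\<close> decay, of "e i" "m ^ ?n" "D 0 (p i)"] \<open>m \<ge> 1\<close>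
        by (simp add: T_def c_def e(1))
    qed
    also have "\<dots> = real (m + 1) * (c * real (m ^ ?n) powr (- \<sigma>))" by simp
    also have "\<dots> \<le> 2 * real m * (c * real (m ^ ?n) powr (- \<sigma>))"
      using \<open>m \<ge> 1\<close> \<open>c \<ge> 0\<close> by (intro mult_right_mono) auto
    also have "real (m ^ ?n) = real m powr ?n" using \<open>m \<ge> 1\<close> by (simp add: powr_realpow)
    also have "2 * real m * (c * (real m powr ?n) powr (- \<sigma>)) = 2 * c * real m powr (1 - ?n * \<sigma>)"
      using \<open>m \<ge> 1\<close> by (simp add: powr_powr powr_diff powr_minus divide_inverse)
    finally show ?thesis .
  qed
  have "(\<lambda>m. 2 * c * real m powr (1 - ?n * \<sigma>)) \<longlonglongrightarrow> 2 * c * 0"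
    using \<sigma> by (intro tendsto_intros tendsto_neg_powr filterlim_real_sequentially) auto
  then have "measure \<mu> (D 0 ` {a..b}) \<le> 2 * c * 0"
    by (rule tendsto_lowerbound) (auto simp: eventually_sequentially intro!: exI[of _ 1] bound)
  then have "measure \<mu> (D 0 ` {a..b}) = 0" by (simp add: measure_le_0_iff)
  then show ?thesis by (simp add: emeasure_eq_measure)
qed auto

section \<open>From null arcs to the upper bound\<close>

text \<open>The complement of the support is the union of all open null sets, and second
  countability lets countably many of them suffice.\<close>

lemma emeasure_compl_measure_support:
  fixes \<mu> :: "'a::second_countable_topology measure"
  assumes "sets \<mu> = sets borel"
  shows "- measure_support \<mu> \<in> null_sets \<mu>"
proof -
  define \<F> where "\<F> = {U. open U \<and> emeasure \<mu> U = 0}"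
  obtain \<F>' where F: "\<F>' \<subseteq> \<F>" "countable \<F>'" "\<Union>\<F>' = \<Union>\<F>"
    using Lindelof[of \<F>] unfolding \<F>_def by blast
  have "- measure_support \<mu> = \<Union>\<F>"
    by (auto simp: measure_support_def \<F>_def zero_less_iff_neq_zero)
  also have "\<dots> = (\<Union>U\<in>\<F>'. U)" using F by simp
  also have "\<dots> \<in> null_sets \<mu>"
    using F by (intro null_sets_UN') (auto simp: \<F>_def null_sets_def assms)
  finally show ?thesis .
qed

text \<open>The arc estimate concerns compact parameter intervals, whereas \<open>I\<close> may be
  unbounded or lack an endpoint; countable additivity bridges the gap.\<close>

lemma interval_countable_cover:
  fixes I :: "real set"
  assumes "is_interval I"
  obtains P where "countable P" "\<And>a b. (a, b) \<in> P \<Longrightarrow> {a..b} \<subseteq> I" "I \<subseteq> (\<Union>(a, b)\<in>P. {a..b})"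
proof
  \<comment> \<open>A rational point of \<open>I\<close> lies on a given side of \<open>t\<close>
    unless \<open>t\<close> is extreme in \<open>I\<close> on that side. Extreme points may be
    irrational, so they are added separately.\<close>
  define Q where "Q = I \<inter> (\<rat> \<union> {x. \<forall>y\<in>I. y \<le> x} \<union> {x. \<forall>y\<in>I. x \<le> y})"
  have subsingleton: "countable A" if "\<And>x y. x \<in> A \<Longrightarrow> y \<in> A \<Longrightarrow> x = y" for A :: "real set"
  proof (cases "A = {}")
    case False
    then obtain u where "u \<in> A" by blast
    then have "A = {u}" using that by blast
    then show ?thesis by simp
  qed simp
  have one: "countable (I \<inter> {x. \<forall>y\<in>I. y \<le> x})" "countable (I \<inter> {x. \<forall>y\<in>I. x \<le> y})"
    by (rule subsingleton; auto intro: order.antisym)+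
  have "countable (I \<inter> \<rat>)" using countable_rat by (intro countable_Int2)
  then have "countable Q" using one by (simp add: Q_def Int_Un_distrib)
  then show "countable (Q \<times> Q)" by simp
  show "{a..b} \<subseteq> I" if "(a, b) \<in> Q \<times> Q" for a b
  proof
    fix x assume "x \<in> {a..b}"
    then show "x \<in> I" using that mem_is_interval_1_I[OF assms, of a b x] by (simp add: Q_def)
  qed
  show "I \<subseteq> (\<Union>(a, b)\<in>Q \<times> Q. {a..b})"
  proof
    fix t assume t: "t \<in> I"
    have "\<exists>b\<in>Q. t \<le> b"
    proof (cases "\<forall>y\<in>I. y \<le> t")
      case False
      then obtain y where "y \<in> I" "t < y" by force
      then obtain r where "r \<in> \<rat>" "t < r" "r < y" using Rats_dense_in_real by blast
      then show ?thesis
        using t \<open>y \<in> I\<close> mem_is_interval_1_I[OF assms, of t y r] by (auto simp: Q_def intro!: bexI[of _ r])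
    qed (use t in \<open>auto simp: Q_def\<close>)
    moreover have "\<exists>a\<in>Q. a \<le> t"
    proof (cases "\<forall>y\<in>I. t \<le> y")
      case False
      then obtain y where "y \<in> I" "y < t" by force
      then obtain r where "r \<in> \<rat>" "y < r" "r < t" using Rats_dense_in_real by blast
      then show ?thesis
        using t \<open>y \<in> I\<close> mem_is_interval_1_I[OF assms, of y t r] by (auto simp: Q_def intro!: bexI[of _ r])
    qed (use t in \<open>auto simp: Q_def\<close>)
    ultimately show "t \<in> (\<Union>(a, b)\<in>Q \<times> Q. {a..b})" by force
  qed
qed

text \<open>With a larger exponent every compact arc is null. Countably many arcs cover the support,
  whose complement is null as well, so the measure would vanish.\<close>

theorem fourier_decay_exponent_curve_le:
  fixes \<gamma> :: "real \<Rightarrow> 'a::euclidean_space"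
  assumes "DIM('a) \<ge> 2" "is_interval I" "smooth_on I \<gamma>"
    and "s \<in> fourier_decay_exponents (\<gamma> ` I)"
  shows "s \<le> 2 / DIM('a)"
proof (rule ccontr)
  assume "\<not> ?thesis"
  then have s: "1 / DIM('a) < s / 2" by (simp add: field_simps)
  have "1 / DIM('a) < (1::real)" using assms(1) by simp
  \<comment> \<open>The slab estimate requires an exponent below 1, while \<open>s / 2\<close> may
    be 1 or more; \<open>DIM('a) \<ge> 2\<close> leaves room between \<open>1 / DIM('a)\<close> and
    1.\<close>
  with s obtain \<sigma> where \<sigma>: "1 / DIM('a) < \<sigma>" "\<sigma> < s / 2" "\<sigma> < 1"
    using dense[of "1 / DIM('a)" "min (s / 2) 1"] by auto
  have "0 < \<sigma>" using \<sigma>(1) by (meson divide_pos_pos of_nat_0_less_iff DIM_positive zero_less_one order.strict_trans)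
  from assms(4) obtain \<mu> :: "'a measure" and K where
    sets: "sets \<mu> = sets borel" and fin: "finite_measure \<mu>" and nz: "emeasure \<mu> UNIV \<noteq> 0"
    and supp: "measure_support \<mu> \<subseteq> \<gamma> ` I"
    and K: "\<And>\<zeta>. \<zeta> \<noteq> 0 \<Longrightarrow> norm (fourier_transform \<mu> \<zeta>) \<le> K * norm \<zeta> powr (- s / 2)"
    unfolding fourier_decay_exponents_def by blast
  have space: "space \<mu> = UNIV" using sets sets_eq_imp_space_eq by fastforce
  \<comment> \<open>At frequencies of norm at least 1, lowering the exponent to
    \<open>\<sigma>\<close> only weakens the bound with \<open>K\<close>. Below norm 1 the total
    mass suffices, since there \<open>norm \<zeta> powr (- \<sigma>) \<ge> 1\<close>.\<close>
  define K' where "K' = \<bar>K\<bar> + measure \<mu> UNIV"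
  have "K \<le> K'"
    unfolding K'_def using abs_ge_self[of K] measure_nonneg[of \<mu> UNIV] by linarith
  have "0 \<le> K'" by (simp add: K'_def)
  have decay: "norm (fourier_transform \<mu> \<zeta>) \<le> K' * norm \<zeta> powr (- \<sigma>)" if "\<zeta> \<noteq> 0" for \<zeta>
  proof (cases "norm \<zeta> \<ge> 1")
    case True
    have "norm (fourier_transform \<mu> \<zeta>) \<le> K * norm \<zeta> powr (- s / 2)" by (rule K[OF that])
    also have "norm \<zeta> powr (- s / 2) \<le> norm \<zeta> powr (- \<sigma>)"
      using True \<sigma> by (intro powr_mono) auto
    then have "K * norm \<zeta> powr (- s / 2) \<le> K' * norm \<zeta> powr (- \<sigma>)"
      using \<open>K \<le> K'\<close> \<open>0 \<le> K'\<close> by (intro mult_mono) auto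
    finally show ?thesis .
  next
    case False
    have "norm (fourier_transform \<mu> \<zeta>) \<le> K' * 1"
      using norm_fourier_transform_le[OF fin, of \<zeta>] by (simp add: K'_def space)
    also have "1 \<le> norm \<zeta> powr (- \<sigma>)"
      using False that \<open>0 < \<sigma>\<close> powr_mono2'[of "-\<sigma>" "norm \<zeta>" 1] by simp
    then have "K' * 1 \<le> K' * norm \<zeta> powr (- \<sigma>)" by (intro mult_left_mono) (auto simp: K'_def)
    finally show ?thesis .
  qed
  obtain P where P: "countable P" "\<And>a b. (a, b) \<in> P \<Longrightarrow> {a..b} \<subseteq> I" "I \<subseteq> (\<Union>(a, b)\<in>P. {a..b})"
    using interval_countable_cover[OF assms(2)] by blast
  have null: "\<gamma> ` {a..b} \<in> null_sets \<mu>" if "(a, b) \<in> P" for a b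
  proof -
    define D where "D k = nth_vector_derivative k I \<gamma>" for k
    have D: "(D k has_vector_derivative D (Suc k) t) (at t within {a..b})" if "t \<in> {a..b}" for k t
      unfolding D_def using P(2)[OF \<open>(a, b) \<in> P\<close>] that
      by (intro has_vector_derivative_within_subset[OF nth_vector_derivative_has_vector_derivative[OF assms(3)]]) auto
    have "1 < DIM('a) * \<sigma>" using \<sigma>(1) by (simp add: field_simps)
    then have "emeasure \<mu> (D 0 ` {a..b}) = 0"
      by (intro emeasure_arc_eq_0[where D=D and K=K', OF sets fin \<open>0 < \<sigma>\<close> \<sigma>(3) _ _ decay D]) (auto simp: K'_def)
    moreover have "compact (D 0 ` {a..b})"
      by (intro compact_continuous_image continuous_on_vector_derivative[OF D]) auto
    ultimately show ?thesis
      using sets by (auto simp: null_sets_def D_def borel_compact)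
  qed
  have "UNIV = - measure_support \<mu> \<union> (\<Union>p\<in>P. \<gamma> ` {fst p..snd p})"
    using supp P(3) by fastforce
  also have "\<dots> \<in> null_sets \<mu>"
    using null P(1) by (intro null_sets.Un emeasure_compl_measure_support sets null_sets_UN') auto
  finally show False using nz by auto
qed

section \<open>Oscillatory integrals\<close>

text \<open>
  \<open>F = cis \<psi>\<^sub>0 / (\<i> * \<psi>\<^sub>1)\<close> is an approximate primitive of \<open>cis \<psi>\<^sub>0\<close>; the derivative of the error is
  bounded by \<open>\<bar>\<psi>\<^sub>2\<bar> / \<psi>\<^sub>1\<^sup>2\<close>, hence by the derivative of \<open>G\<close>.
\<close>

lemma oscillatory_integral_first_derivative:
  fixes \<psi>\<^sub>0 \<psi>\<^sub>1 \<psi>\<^sub>2 G G' :: "real \<Rightarrow> real"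
  assumes "a \<le> b" "L > 0"
    and d0: "\<And>t. t \<in> {a..b} \<Longrightarrow> (\<psi>\<^sub>0 has_real_derivative \<psi>\<^sub>1 t) (at t within {a..b})"
    and d1: "\<And>t. t \<in> {a..b} \<Longrightarrow> (\<psi>\<^sub>1 has_real_derivative \<psi>\<^sub>2 t) (at t within {a..b})"
    and low: "\<And>t. t \<in> {a..b} \<Longrightarrow> L \<le> \<bar>\<psi>\<^sub>1 t\<bar>"
    and G: "\<And>t. t \<in> {a..b} \<Longrightarrow> (G has_real_derivative G' t) (at t within {a..b})"
    and GG: "\<And>t. t \<in> {a..b} \<Longrightarrow> \<bar>\<psi>\<^sub>2 t\<bar> / (\<psi>\<^sub>1 t)\<^sup>2 \<le> G' t"
  shows "norm (integral {a..b} (\<lambda>t. cis (\<psi>\<^sub>0 t))) \<le> 2 / L + (G b - G a)"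
proof -
  have nz: "\<psi>\<^sub>1 t \<noteq> 0" if "t \<in> {a..b}" for t using low[OF that] \<open>L > 0\<close> by auto
  define E where "E u = integral {a..u} (\<lambda>t. cis (\<psi>\<^sub>0 t))" for u
  define F where "F t = - \<i> * (cis (\<psi>\<^sub>0 t) * complex_of_real (inverse (\<psi>\<^sub>1 t)))" for t
  have cont: "continuous_on {a..b} (\<lambda>t. cis (\<psi>\<^sub>0 t))"
    unfolding cis_conv_exp
    by (intro continuous_intros DERIV_continuous_on[OF d0])
  have dE: "(E has_vector_derivative cis (\<psi>\<^sub>0 t)) (at t within {a..b})" if "t \<in> {a..b}" for t
    unfolding E_def by (rule integral_has_vector_derivative[OF cont that])
  have dF: "(F has_vector_derivative
      cis (\<psi>\<^sub>0 t) + \<i> * cis (\<psi>\<^sub>0 t) * complex_of_real (\<psi>\<^sub>2 t / (\<psi>\<^sub>1 t)\<^sup>2)) (at t within {a..b})"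
    if t: "t \<in> {a..b}" for t
  proof -
    have 1: "((\<lambda>t. cis (\<psi>\<^sub>0 t)) has_vector_derivative \<psi>\<^sub>1 t *\<^sub>R (\<i> * cis (\<psi>\<^sub>0 t))) (at t within {a..b})"
      using has_derivative_cis[OF d0[OF t, unfolded has_field_derivative_def]]
      by (simp add: has_vector_derivative_def mult.commute)
    have 2: "((\<lambda>t. complex_of_real (inverse (\<psi>\<^sub>1 t))) has_vector_derivative
        complex_of_real (- (\<psi>\<^sub>2 t / (\<psi>\<^sub>1 t)\<^sup>2))) (at t within {a..b})"
      using nz[OF t]
      by (intro has_vector_derivative_of_real)
         (auto intro!: derivative_eq_intros d1[OF t]
           simp: has_real_derivative_iff_has_vector_derivative[symmetric] field_simps power2_eq_square)
    show ?thesis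
      unfolding F_def
      by (rule has_vector_derivative_eq_rhs[OF has_vector_derivative_mult_right[OF has_vector_derivative_mult[OF 1 2]]])
        (use nz[OF t] in \<open>auto simp: scaleR_conv_of_real field_simps\<close>)
  qed
  have "norm ((E b - F b) - (E a - F a)) \<le> G b - G a"
  proof (cases "a < b")
    case True
    show ?thesis
    proof (rule differentiable_bound_general[OF True, where \<phi>'=G' and
          f'="\<lambda>t. - (\<i> * cis (\<psi>\<^sub>0 t) * complex_of_real (\<psi>\<^sub>2 t / (\<psi>\<^sub>1 t)\<^sup>2))"])
      show "continuous_on {a..b} (\<lambda>t. E t - F t)"
        using dE dF by (intro continuous_on_diff continuous_on_vector_derivative) blast+
      show "continuous_on {a..b} G" using DERIV_continuous_on G by blast
    next
      fix t assume t: "a < t" "t < b"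
      then have at: "at t within {a..b} = at t" by (intro at_within_interior) auto
      show "((\<lambda>t. E t - F t) has_vector_derivative - (\<i> * cis (\<psi>\<^sub>0 t) * complex_of_real (\<psi>\<^sub>2 t / (\<psi>\<^sub>1 t)\<^sup>2))) (at t)"
        using has_vector_derivative_diff[OF dE[of t] dF[of t]] t by (simp add: at)
      show "(G has_vector_derivative G' t) (at t)"
        using G[of t] t by (simp add: at has_real_derivative_iff_has_vector_derivative)
      show "norm (- (\<i> * cis (\<psi>\<^sub>0 t) * complex_of_real (\<psi>\<^sub>2 t / (\<psi>\<^sub>1 t)\<^sup>2))) \<le> G' t"
        using GG[of t] t by (simp add: norm_mult norm_divide norm_power)
    qed
  qed (use \<open>a \<le> b\<close> in auto)
  \<comment> \<open>The two boundary values of \<open>F\<close> account for \<open>2 / L\<close>.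
    Since \<open>E a = 0\<close>, the rest of \<open>E b\<close> is the increment of the error
    \<open>E - F\<close>.\<close>
  moreover have "norm (F t) \<le> 1 / L" if "t \<in> {a..b}" for t
    using low[OF that] nz[OF that] \<open>L > 0\<close>
    by (simp add: F_def norm_mult norm_divide divide_simps)
  then have "norm (F a) \<le> 1 / L" "norm (F b) \<le> 1 / L" using \<open>a \<le> b\<close> by auto
  moreover have "E b = ((E b - F b) - (E a - F a)) + F b - F a" by (simp add: E_def)
  then have "norm (E b) \<le> norm ((E b - F b) - (E a - F a)) + norm (F b) + norm (F a)"
    by (smt (verit) norm_triangle_ineq norm_triangle_ineq4)
  ultimately show ?thesis unfolding E_def by simp
qed

lemma constant_sign_if_bounded_away_from_zero:
  fixes f :: "real \<Rightarrow> real"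
  assumes "continuous_on {a..b} f" "L > 0" "\<And>t. t \<in> {a..b} \<Longrightarrow> L \<le> \<bar>f t\<bar>"
  shows "(\<forall>t\<in>{a..b}. L \<le> f t) \<or> (\<forall>t\<in>{a..b}. f t \<le> - L)"
proof (rule ccontr)
  assume "\<not> ?thesis"
  then obtain s t where st: "s \<in> {a..b}" "t \<in> {a..b}" "f s < L" "- L < f t" by force
  then have "f s < 0" "f t > 0" using assms(2,3) by (smt (verit))+
  moreover have "is_interval (f ` {a..b})"
    using connected_continuous_image[OF assms(1)] by (simp add: is_interval_connected_1)
  ultimately have "0 \<in> f ` {a..b}"
    using st by (meson imageI less_imp_le mem_is_interval_1_I)
  then show False using assms(2,3) by force
qed

text \<open>The constant depends on \<open>k\<close> alone, because the induction changes the
  interval and replaces \<open>L\<close>. The extra condition for \<open>k = 1\<close> makes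
  \<open>\<phi> 1\<close> monotone; size alone gives no such bound there. Differentiability up to
  \<open>j = k\<close> makes \<open>\<phi> k\<close> continuous, hence of constant sign.\<close>

theorem van_der_Corput:
  assumes "k \<ge> 1"
  shows "\<exists>c>0. \<forall>\<phi> a b L. a \<le> b \<longrightarrow> L > 0 \<longrightarrow>
      (\<forall>j\<le>k. \<forall>t\<in>{a..b}. (\<phi> j has_real_derivative \<phi> (Suc j) t) (at t within {a..b})) \<longrightarrow>
      (\<forall>t\<in>{a..b}. L \<le> \<bar>\<phi> k t\<bar>) \<longrightarrow>
      (k = 1 \<longrightarrow> (\<forall>t\<in>{a..b}. 0 \<le> \<phi> 2 t) \<or> (\<forall>t\<in>{a..b}. \<phi> 2 t \<le> 0)) \<longrightarrow>
      norm (integral {a..b} (\<lambda>t. cis (\<phi> 0 t))) \<le> c * L powr (- 1 / real k)"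
  using assms
proof (induction k rule: dec_induct)
  case base
  have "norm (integral {a..b} (\<lambda>t. cis (\<phi> 0 t))) \<le> 4 * L powr (- 1 / real 1)"
    if ab: "a \<le> b" and l: "L > 0"
      and d: "\<forall>j\<le>1. \<forall>t\<in>{a..b}. (\<phi> j has_real_derivative \<phi> (Suc j) t) (at t within {a..b})"
      and low: "\<forall>t\<in>{a..b}. L \<le> \<bar>\<phi> 1 t\<bar>"
      and sgn: "(\<forall>t\<in>{a..b}. 0 \<le> \<phi> 2 t) \<or> (\<forall>t\<in>{a..b}. \<phi> 2 t \<le> 0)"
    for \<phi> :: "nat \<Rightarrow> real \<Rightarrow> real" and a b L
  proof -
    have d0: "(\<phi> 0 has_real_derivative \<phi> 1 t) (at t within {a..b})"
      and d1: "(\<phi> 1 has_real_derivative \<phi> 2 t) (at t within {a..b})" if "t \<in> {a..b}" for t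
      using d[rule_format, of 0 t] d[rule_format, of 1 t] that by (simp_all add: numeral_2_eq_2)
    have nz: "\<phi> 1 t \<noteq> 0" if "t \<in> {a..b}" for t using low l that by force
    have inv: "\<bar>inverse (\<phi> 1 t)\<bar> \<le> 1 / L" if "t \<in> {a..b}" for t
      using low l that nz[OF that] by (auto simp: field_simps)
    obtain s :: real where s: "\<bar>s\<bar> = 1" "\<And>t. t \<in> {a..b} \<Longrightarrow> \<bar>\<phi> 2 t\<bar> = s * \<phi> 2 t"
      using sgn by (metis abs_minus_cancel abs_of_nonneg abs_of_nonpos abs_one mult_1 mult_minus1)
    \<comment> \<open>The sign \<open>s\<close> makes the derivative of \<open>G\<close> equal to
      \<open>\<bar>\<phi> 2 t\<bar> / (\<phi> 1 t)\<^sup>2\<close>, so the error costs only boundary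
      values of \<open>1 / \<phi> 1\<close>, at most \<open>2 / L\<close>. With the other
      \<open>2 / L\<close> this gives the constant 4.\<close>
    define G where "G t = - s * inverse (\<phi> 1 t)" for t
    have "norm (integral {a..b} (\<lambda>t. cis (\<phi> 0 t))) \<le> 2 / L + (G b - G a)"
    proof (rule oscillatory_integral_first_derivative[OF ab l d0 d1])
      show "(G has_real_derivative \<bar>\<phi> 2 t\<bar> / (\<phi> 1 t)\<^sup>2) (at t within {a..b})" if "t \<in> {a..b}" for t
        unfolding G_def using nz[OF that] s(2)[OF that]
        by (auto intro!: derivative_eq_intros d1[OF that, unfolded One_nat_def] simp: field_simps power2_eq_square)
    qed (use low in auto)
    moreover have "\<bar>G b\<bar> \<le> 1 / L" "\<bar>G a\<bar> \<le> 1 / L"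
      using inv ab s(1) by (auto simp: G_def abs_mult)
    moreover have "L powr (- 1 / real 1) = 1 / L" using l by (simp add: powr_minus_divide)
    ultimately show ?thesis by (simp add: abs_le_iff)
  qed
  then show ?case by (intro exI[of _ "4::real"]) auto
next
  case (step k)
  then obtain c where "c > 0" and c: "\<And>\<phi> a b L. a \<le> b \<Longrightarrow> L > 0 \<Longrightarrow>
    (\<forall>j\<le>k. \<forall>t\<in>{a..b}. (\<phi> j has_real_derivative \<phi> (Suc j) t) (at t within {a..b})) \<Longrightarrow>
    (\<forall>t\<in>{a..b}. L \<le> \<bar>\<phi> k t\<bar>) \<Longrightarrow>
    (k = 1 \<longrightarrow> (\<forall>t\<in>{a..b}. 0 \<le> \<phi> 2 t) \<or> (\<forall>t\<in>{a..b}. \<phi> 2 t \<le> 0)) \<Longrightarrow>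
    norm (integral {a..b} (\<lambda>t. cis (\<phi> 0 t))) \<le> c * L powr (- 1 / real k)"
    by blast
  \<comment> \<open>A lower bound without absolute value makes \<open>\<phi> k\<close> grow at rate
    at least \<open>L\<close>, so that it can be small only near one point.\<close>
  have pos: "norm (integral {a..b} (\<lambda>t. cis (\<phi> 0 t))) \<le> (2 * c + 2) * L powr (- 1 / real (Suc k))"
    if ab: "a \<le> b" and l: "L > 0"
      and d: "\<forall>j\<le>Suc k. \<forall>t\<in>{a..b}. (\<phi> j has_real_derivative \<phi> (Suc j) t) (at t within {a..b})"
      and low: "\<forall>t\<in>{a..b}. L \<le> \<phi> (Suc k) t"
    for \<phi> :: "nat \<Rightarrow> real \<Rightarrow> real" and a b L
  proof -
    define r where "r = L powr (- 1 / real (Suc k))"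
    have "r > 0" using l by (simp add: r_def)
    have incr: "L * (t - s) \<le> \<phi> k t - \<phi> k s" if "s \<in> {a..b}" "t \<in> {a..b}" "s \<le> t" for s t
    proof -
      have "\<exists>x\<in>{s..t}. \<phi> k t - \<phi> k s = \<phi> (Suc k) x * (t - s)"
      proof (rule mvt_very_simple[OF \<open>s \<le> t\<close>, of "\<phi> k" "\<lambda>x. (*) (\<phi> (Suc k) x)"])
        fix x assume "s \<le> x" "x \<le> t"
        then show "(\<phi> k has_derivative (*) (\<phi> (Suc k) x)) (at x within {s..t})"
          using d[rule_format, of k x] that
          by (auto simp: has_field_derivative_def intro: has_derivative_subset)
      qed
      then obtain x where "x \<in> {s..t}" "\<phi> k t - \<phi> k s = \<phi> (Suc k) x * (t - s)" by blast
      then show ?thesis using low that by (auto intro!: mult_right_mono)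
    qed
    \<comment> \<open>Outside the interval of radius \<open>r\<close> around \<open>z\<close> the induction hypothesis applies with \<open>L * r\<close>
      in place of \<open>L\<close>, and \<open>r\<close> balances its bound against the trivial bound inside.\<close>
    obtain z where z: "z \<in> {a..b}" "\<And>t. t \<in> {a..b} \<Longrightarrow> L * \<bar>t - z\<bar> \<le> \<bar>\<phi> k t\<bar>"
    proof -
      note found = that
      have zero: thesis if "z \<in> {a..b}" "\<phi> k z = 0" for z
      proof (rule found[OF \<open>z \<in> {a..b}\<close>])
        fix t assume "t \<in> {a..b}"
        then show "L * \<bar>t - z\<bar> \<le> \<bar>\<phi> k t\<bar>"
          using incr[of t z] incr[of z t] that by (cases "t \<le> z") (auto simp: abs_if algebra_simps)
      qed
      \<comment> \<open>As \<open>\<phi> k\<close> is increasing, \<open>z\<close> can be the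
        endpoint where it is closest to 0 if it keeps one sign, and a zero of it otherwise.\<close>
      consider "\<phi> k a \<ge> 0" | "\<phi> k b \<le> 0" | "\<phi> k a \<le> 0" "0 \<le> \<phi> k b" by linarith
      then show thesis
      proof cases
        case 1
        show thesis
        proof (rule found[of a])
          fix t assume "t \<in> {a..b}"
          then show "L * \<bar>t - a\<bar> \<le> \<bar>\<phi> k t\<bar>" using incr[of a t] 1 by auto
        qed (use ab in auto)
      next
        case 2
        show thesis
        proof (rule found[of b])
          fix t assume "t \<in> {a..b}"
          then show "L * \<bar>t - b\<bar> \<le> \<bar>\<phi> k t\<bar>" using incr[of t b] 2 by (auto simp: algebra_simps)
        qed (use ab in auto)
      next
        case 3
        have "continuous_on {a..b} (\<phi> k)"
          using d by (intro DERIV_continuous_on[where D="\<phi> (Suc k)"]) auto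
        then obtain z where "a \<le> z" "z \<le> b" "\<phi> k z = 0"
          using IVT'[of "\<phi> k" a 0 b] 3 ab by blast
        then show thesis using zero by auto
      qed
    qed
    have part: "norm (integral {s..t} (\<lambda>t. cis (\<phi> 0 t))) \<le> c * r"
      if st: "a \<le> s" "s \<le> t" "t \<le> b" and far: "\<And>x. x \<in> {s..t} \<Longrightarrow> r \<le> \<bar>x - z\<bar>" for s t
    proof -
      have "norm (integral {s..t} (\<lambda>t. cis (\<phi> 0 t))) \<le> c * (L * r) powr (- 1 / real k)"
      proof (rule c[OF \<open>s \<le> t\<close>])
        show "0 < L * r" using l \<open>r > 0\<close> by simp
        show "\<forall>j\<le>k. \<forall>x\<in>{s..t}. (\<phi> j has_real_derivative \<phi> (Suc j) x) (at x within {s..t})"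
        proof (intro allI impI ballI)
          fix j x assume "j \<le> k" "x \<in> {s..t}"
          then have "(\<phi> j has_real_derivative \<phi> (Suc j) x) (at x within {a..b})" using d st by auto
          then show "(\<phi> j has_real_derivative \<phi> (Suc j) x) (at x within {s..t})"
            by (rule has_field_derivative_subset) (use st in auto)
        qed
        show "\<forall>t\<in>{s..t}. L * r \<le> \<bar>\<phi> k t\<bar>"
        proof
          fix x assume x: "x \<in> {s..t}"
          then have "L * r \<le> L * \<bar>x - z\<bar>" using far l by (intro mult_left_mono) auto
          also have "\<dots> \<le> \<bar>\<phi> k x\<bar>" using x st by (intro z(2)) auto
          finally show "L * r \<le> \<bar>\<phi> k x\<bar>" .
        qed
        \<comment> \<open>When \<open>k = 1\<close>, the function \<open>\<phi> (Suc k)\<close> is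
          \<open>\<phi> 2\<close>, so its lower bound supplies the monotonicity that the induction
          hypothesis asks for.\<close>
        show "k = 1 \<longrightarrow> (\<forall>x\<in>{s..t}. 0 \<le> \<phi> 2 x) \<or> (\<forall>x\<in>{s..t}. \<phi> 2 x \<le> 0)"
        proof (intro impI disjI1 ballI)
          fix x assume "k = 1" "x \<in> {s..t}"
          then show "0 \<le> \<phi> 2 x" using low[rule_format, of x] l st by (simp add: numeral_2_eq_2)
        qed
      qed
      also have "(L * r) powr (- 1 / real k) = r"
      proof -
        have "L * r = L powr (1 + (- 1 / real (Suc k)))"
          unfolding r_def powr_add using l by simp
        also have "1 + (- 1 / real (Suc k)) = real k / real (Suc k)" by (simp add: field_simps)
        finally show ?thesis using \<open>1 \<le> k\<close> by (simp add: r_def powr_powr)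
      qed
      finally show ?thesis .
    qed
    define s where "s = max a (z - r)"
    define t where "t = min b (z + r)"
    have st: "a \<le> s" "s \<le> t" "t \<le> b" "t - s \<le> 2 * r"
      using z(1) \<open>r > 0\<close> by (auto simp: s_def t_def)
    have int: "(\<lambda>t. cis (\<phi> 0 t)) integrable_on {u..v}" if "a \<le> u" "v \<le> b" for u v
    proof (rule integrable_continuous_real)
      have "continuous_on {a..b} (\<phi> 0)"
          using d by (intro DERIV_continuous_on[where D="\<phi> (Suc 0)"]) auto
      then have "continuous_on {u..v} (\<phi> 0)" by (rule continuous_on_subset) (use that in auto)
      then show "continuous_on {u..v} (\<lambda>t. cis (\<phi> 0 t))"
        unfolding cis_conv_exp by (intro continuous_intros)
    qed
    have split: "integral {a..b} (\<lambda>t. cis (\<phi> 0 t)) = integral {a..s} (\<lambda>t. cis (\<phi> 0 t)) +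
        integral {s..t} (\<lambda>t. cis (\<phi> 0 t)) + integral {t..b} (\<lambda>t. cis (\<phi> 0 t))"
      using Henstock_Kurzweil_Integration.integral_combine[OF st(1) order_trans[OF st(2,3)] int[OF order_refl order_refl]]
        Henstock_Kurzweil_Integration.integral_combine[OF st(2,3) int[OF st(1) order_refl]] by (metis add.assoc)
    have left: "norm (integral {a..s} (\<lambda>t. cis (\<phi> 0 t))) \<le> c * r"
    proof (cases "z - r \<le> a")
      case True
      then show ?thesis using \<open>c > 0\<close> \<open>r > 0\<close> by (simp add: s_def max_def)
    next
      case False
      show ?thesis by (rule part) (use False st in \<open>auto simp: s_def\<close>)
    qed
    have right: "norm (integral {t..b} (\<lambda>t. cis (\<phi> 0 t))) \<le> c * r"
    proof (cases "b \<le> z + r")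
      case True
      then show ?thesis using \<open>c > 0\<close> \<open>r > 0\<close> by (simp add: t_def min_def)
    next
      case False
      show ?thesis by (rule part) (use False st in \<open>auto simp: t_def\<close>)
    qed
    have "norm (integral {s..t} (\<lambda>t. cis (\<phi> 0 t))) \<le> t - s"
      using integral_norm_bound_integral[OF int[OF st(1,3)] integrable_const_ivl[of 1 s t]] st by simp
    then have middle: "norm (integral {s..t} (\<lambda>t. cis (\<phi> 0 t))) \<le> 2 * r"
      using st(4) by linarith
    have "norm (integral {a..b} (\<lambda>t. cis (\<phi> 0 t))) \<le> c * r + 2 * r + c * r"
      unfolding split by (intro norm_triangle_mono left middle right)
    then show ?thesis by (simp add: r_def algebra_simps)
  qed
  have "norm (integral {a..b} (\<lambda>t. cis (\<phi> 0 t))) \<le> (2 * c + 2) * L powr (- 1 / real (Suc k))"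
    if ab: "a \<le> b" and l: "L > 0"
      and d: "\<forall>j\<le>Suc k. \<forall>t\<in>{a..b}. (\<phi> j has_real_derivative \<phi> (Suc j) t) (at t within {a..b})"
      and low: "\<forall>t\<in>{a..b}. L \<le> \<bar>\<phi> (Suc k) t\<bar>"
    for \<phi> :: "nat \<Rightarrow> real \<Rightarrow> real" and a b L
  proof -
    have "continuous_on {a..b} (\<phi> (Suc k))"
      using d by (intro DERIV_continuous_on[where D="\<phi> (Suc (Suc k))"]) auto
    from constant_sign_if_bounded_away_from_zero[OF this l] low
    consider "\<forall>t\<in>{a..b}. L \<le> \<phi> (Suc k) t" | "\<forall>t\<in>{a..b}. \<phi> (Suc k) t \<le> - L" by blast
    then show ?thesis
    proof cases
      case 1
      then show ?thesis using pos ab l d by blast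
    next
      case 2
      \<comment> \<open>Reversing the sign of the phase conjugates the integral and preserves its
        norm.\<close>
      have "norm (integral {a..b} (\<lambda>t. cis (- \<phi> 0 t))) \<le> (2 * c + 2) * L powr (- 1 / real (Suc k))"
      proof (rule pos[OF ab l, where \<phi>="\<lambda>j t. - \<phi> j t"])
        show "\<forall>j\<le>Suc k. \<forall>t\<in>{a..b}.
            ((\<lambda>t. - \<phi> j t) has_real_derivative - \<phi> (Suc j) t) (at t within {a..b})"
          using d by (auto intro: DERIV_minus)
        show "\<forall>t\<in>{a..b}. L \<le> - \<phi> (Suc k) t" using 2 by force
      qed
      also have "integral {a..b} (\<lambda>t. cis (- \<phi> 0 t)) = cnj (integral {a..b} (\<lambda>t. cis (\<phi> 0 t)))"
        by (simp add: integral_cnj cis_cnj)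
      finally show ?thesis by simp
    qed
  qed
  then show ?case using \<open>c > 0\<close> by (intro exI[of _ "2 * c + 2"]) auto
qed

section \<open>The measure on a short arc and the lower bound\<close>

text \<open>The family spans, so the sum \<open>g\<close> of the
  \<open>\<bar>v k \<bullet> x\<bar>\<close> vanishes only at 0 and has a positive minimum on the
  compact unit sphere; homogeneity carries this to all \<open>x\<close>.\<close>

lemma nondegenerate_family_lower_bound:
  fixes v :: "nat \<Rightarrow> 'a::euclidean_space"
  assumes "inj_on v {1..DIM('a)}" "independent (v ` {1..DIM('a)})"
  obtains c where "c > 0" "\<And>x. \<exists>k\<in>{1..DIM('a)}. c * norm x \<le> \<bar>v k \<bullet> x\<bar>"
proof -
  let ?n = "DIM('a)"
  define g where "g x = (\<Sum>k=1..?n. \<bar>v k \<bullet> x\<bar>)" for x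
  have "continuous_on (sphere 0 1) g" unfolding g_def by (intro continuous_intros)
  moreover have "sphere (0::'a) 1 \<noteq> {}" by simp
  ultimately obtain u where u: "u \<in> sphere 0 1" "\<And>x. x \<in> sphere 0 1 \<Longrightarrow> g u \<le> g x"
    using continuous_attains_inf[of "sphere (0::'a) 1" g] by auto
  have "g u > 0"
  proof (rule ccontr)
    assume "\<not> g u > 0"
    then have "g u = 0" by (simp add: g_def sum_nonneg order.antisym not_less)
    then have "\<forall>k\<in>{1..?n}. v k \<bullet> u = 0" by (simp add: g_def sum_nonneg_eq_0_iff)
    then have orth: "\<And>y. y \<in> v ` {1..?n} \<Longrightarrow> orthogonal u y"
      by (auto simp: orthogonal_def inner_commute)
    have "card (v ` {1..?n}) = ?n" using assms(1) by (simp add: card_image)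
    then have "span (v ` {1..?n}) = UNIV"
      using assms(2) by (metis dim_eq_full dim_eq_card_independent)
    then have "orthogonal u u" using orthogonal_to_span[OF _ orth] by auto
    then show False using u(1) by (auto simp: orthogonal_def)
  qed
  \<comment> \<open>The largest summand is at least the mean of the summands, whence the division by
    their number.\<close>
  define c where "c = g u / ?n"
  show thesis
  proof (rule that)
    show "c > 0" using \<open>g u > 0\<close> by (simp add: c_def)
    fix x :: 'a
    show "\<exists>k\<in>{1..?n}. c * norm x \<le> \<bar>v k \<bullet> x\<bar>"
    proof (rule ccontr)
      assume "\<not> ?thesis"
      then have "(\<Sum>k=1..?n. \<bar>v k \<bullet> x\<bar>) < (\<Sum>k=1..?n. c * norm x)"
        by (intro sum_strict_mono) (auto simp: not_le Suc_le_eq)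
      then have less: "g x < g u * norm x" by (simp add: g_def c_def)
      then have "x \<noteq> 0" by (auto simp: g_def)
      then have "g u \<le> g (x /\<^sub>R norm x)" by (intro u(2)) simp
      also have "\<dots> = g x / norm x"
        by (simp add: g_def abs_mult sum_distrib_left divide_inverse mult.commute)
      finally show False using less \<open>x \<noteq> 0\<close> by (simp add: pos_le_divide_eq)
    qed
  qed
qed

text \<open>A change of variables turns the Fourier transform of the image measure into an
  oscillatory integral over the parameter. The arc is compact, so its complement is an open null set
  and the closed support stays on the arc.\<close>

lemma fourier_transform_arc_measure:
  fixes \<gamma> :: "real \<Rightarrow> 'a::euclidean_space"
  assumes "a < b" and cont: "continuous_on {a..b} \<gamma>"
  defines "\<mu> \<equiv> distr (restrict_space lborel {a..b}) borel \<gamma>"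
  shows "sets \<mu> = sets borel" "finite_measure \<mu>" "emeasure \<mu> UNIV \<noteq> 0"
    "measure_support \<mu> \<subseteq> \<gamma> ` {a..b}"
    "fourier_transform \<mu> \<zeta> = integral {a..b} (\<lambda>t. cis (- 2 * pi * (\<gamma> t \<bullet> \<zeta>)))"
proof -
  let ?R = "restrict_space lborel {a..b}"
  have meas[measurable]: "\<gamma> \<in> measurable ?R borel"
    using borel_measurable_continuous_on_restrict[OF cont]
    by (simp add: measurable_cong_sets[OF sets_restrict_space_cong[OF sets_lborel] refl])
  show "sets \<mu> = sets borel" by (simp add: \<mu>_def)
  have UNIV: "emeasure \<mu> UNIV = ennreal (b - a)"
    using \<open>a < b\<close> by (simp add: \<mu>_def emeasure_distr space_restrict_space emeasure_restrict_space)
  show "finite_measure \<mu>"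
    by (rule finite_measureI) (use UNIV in \<open>simp add: \<mu>_def\<close>)
  show "emeasure \<mu> UNIV \<noteq> 0" using UNIV \<open>a < b\<close> by simp
  show "measure_support \<mu> \<subseteq> \<gamma> ` {a..b}"
  proof
    fix x assume x: "x \<in> measure_support \<mu>"
    have "compact (\<gamma> ` {a..b})" by (intro compact_continuous_image cont) auto
    then have "open (- \<gamma> ` {a..b})" using compact_imp_closed by (auto simp: open_Compl)
    moreover have "emeasure \<mu> (- \<gamma> ` {a..b}) = emeasure ?R (\<gamma> -` (- \<gamma> ` {a..b}) \<inter> space ?R)"
      unfolding \<mu>_def using calculation by (intro emeasure_distr) auto
    moreover have "\<gamma> -` (- \<gamma> ` {a..b}) \<inter> space ?R = {}" by (auto simp: space_restrict_space)
    ultimately show "x \<in> \<gamma> ` {a..b}"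
      using x by (force simp: measure_support_def)
  qed
  have c: "continuous_on {a..b} (\<lambda>t. cis (- 2 * pi * (\<gamma> t \<bullet> \<zeta>)))"
    unfolding cis_conv_exp by (intro continuous_intros cont)
  have "continuous_on UNIV (\<lambda>x. cis (- 2 * pi * (x \<bullet> \<zeta>)))"
    unfolding cis_conv_exp by (intro continuous_intros)
  then have "fourier_transform \<mu> \<zeta> = (LINT t|?R. cis (- 2 * pi * (\<gamma> t \<bullet> \<zeta>)))"
    unfolding fourier_transform_def \<mu>_def
    by (intro integral_distr meas borel_measurable_continuous_onI)
  also have "\<dots> = (LINT t:{a..b}|lborel. cis (- 2 * pi * (\<gamma> t \<bullet> \<zeta>)))"
    unfolding set_lebesgue_integral_def by (rule integral_restrict_space) simp
  also have "\<dots> = integral {a..b} (\<lambda>t. cis (- 2 * pi * (\<gamma> t \<bullet> \<zeta>)))"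
    by (intro set_borel_integral_eq_integral borel_integrable_atLeastAtMost' c)
  finally show "fourier_transform \<mu> \<zeta> = integral {a..b} (\<lambda>t. cis (- 2 * pi * (\<gamma> t \<bullet> \<zeta>)))" .
qed

text \<open>For \<open>k \<ge> 2\<close>, van der Corput's lemma with \<open>L\<close> proportional
  to \<open>norm \<zeta>\<close> gives the power \<open>- 1 / k\<close>, which is at most the power
  \<open>- 1 / n\<close> because \<open>norm \<zeta> \<ge> 1\<close>. For \<open>k = 1\<close> the
  derivative of the phase need not be monotone; instead, compactness bounds the second derivative of
  the phase by a multiple of \<open>norm \<zeta>\<close>, against the square of
  \<open>norm \<zeta>\<close> in the denominator.\<close>

lemma arc_fourier_decay:
  fixes D :: "nat \<Rightarrow> real \<Rightarrow> 'a::euclidean_space"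
  assumes "a \<le> b" "c > 0" "1 \<le> k" "k \<le> n"
    and D: "\<And>k t. t \<in> {a..b} \<Longrightarrow> (D k has_vector_derivative D (Suc k) t) (at t within {a..b})"
  obtains A where "\<And>\<zeta>. norm \<zeta> \<ge> 1 \<Longrightarrow> (\<And>t. t \<in> {a..b} \<Longrightarrow> c * norm \<zeta> \<le> \<bar>D k t \<bullet> \<zeta>\<bar>) \<Longrightarrow>
     norm (integral {a..b} (\<lambda>t. cis (- 2 * pi * (D 0 t \<bullet> \<zeta>)))) \<le> A * norm \<zeta> powr (- 1 / real n)"
proof -
  define \<phi> where "\<phi> \<zeta> j t = - 2 * pi * (D j t \<bullet> \<zeta>)" for \<zeta> j t
  have d: "(\<phi> \<zeta> j has_real_derivative \<phi> \<zeta> (Suc j) t) (at t within {a..b})" if "t \<in> {a..b}" for \<zeta> j t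
    unfolding \<phi>_def
    by (intro DERIV_cmult) (use bounded_linear.has_vector_derivative[OF bounded_linear_inner_left D[OF that]]
        in \<open>simp add: has_real_derivative_iff_has_vector_derivative\<close>)
  define L where "L \<zeta> = 2 * pi * (c * norm \<zeta>)" for \<zeta> :: 'a
  have L: "L \<zeta> \<le> \<bar>\<phi> \<zeta> k t\<bar>" if "c * norm \<zeta> \<le> \<bar>D k t \<bullet> \<zeta>\<bar>" for \<zeta> t
    using that by (simp add: L_def \<phi>_def abs_mult)
  have Lpos: "L \<zeta> > 0" if "norm \<zeta> \<ge> 1" for \<zeta>
  proof -
    have "norm \<zeta> > 0" using that by linarith
    then show ?thesis using \<open>c > 0\<close> by (simp add: L_def)
  qed
  have weaken: "norm \<zeta> powr (- 1 / real k) \<le> norm \<zeta> powr (- 1 / real n)" if "norm \<zeta> \<ge> 1" for \<zeta> :: 'a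
    using assms(3,4) that by (intro powr_mono) (auto simp: divide_simps)
  show thesis
  proof (cases "k = 1")
    case True
    have "bounded (D 2 ` {a..b})"
      by (intro compact_imp_bounded compact_continuous_image continuous_on_vector_derivative[OF D]) auto
    then obtain M where M: "\<And>t. t \<in> {a..b} \<Longrightarrow> norm (D 2 t) \<le> M"
      unfolding bounded_iff by blast
    \<comment> \<open>This is \<open>2 / L \<zeta> + B * (b - a)\<close>, with \<open>B\<close> as
      defined below, after the factor \<open>1 / norm \<zeta>\<close> is taken out.\<close>
    define A where "A = 2 / (2 * pi * c) + 2 * pi * M / (2 * pi * c)\<^sup>2 * (b - a)"
    have "M \<ge> 0" using order_trans[OF norm_ge_zero M[of a]] \<open>a \<le> b\<close> by simp
    then have "A \<ge> 0" using \<open>c > 0\<close> \<open>a \<le> b\<close> by (simp add: A_def)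
    show thesis
    proof (rule that[of A])
      fix \<zeta> :: 'a
      assume \<zeta>: "norm \<zeta> \<ge> 1" and low: "\<And>t. t \<in> {a..b} \<Longrightarrow> c * norm \<zeta> \<le> \<bar>D k t \<bullet> \<zeta>\<bar>"
      define B where "B = 2 * pi * M * norm \<zeta> / (L \<zeta>)\<^sup>2"
      have "norm (integral {a..b} (\<lambda>t. cis (\<phi> \<zeta> 0 t))) \<le> 2 / L \<zeta> + (B * b - B * a)"
      proof (rule oscillatory_integral_first_derivative[OF \<open>a \<le> b\<close> Lpos[OF \<zeta>],
            where \<psi>\<^sub>1="\<phi> \<zeta> 1" and \<psi>\<^sub>2="\<phi> \<zeta> 2" and G'="\<lambda>_. B"])
        fix t assume t: "t \<in> {a..b}"
        show "(\<phi> \<zeta> 0 has_real_derivative \<phi> \<zeta> 1 t) (at t within {a..b})"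
          "(\<phi> \<zeta> 1 has_real_derivative \<phi> \<zeta> 2 t) (at t within {a..b})"
          using d[OF t, of \<zeta> 0] d[OF t, of \<zeta> 1] by (simp_all add: numeral_2_eq_2)
        show "((*) B has_real_derivative B) (at t within {a..b})"
          by (auto intro!: derivative_eq_intros)
        show low': "L \<zeta> \<le> \<bar>\<phi> \<zeta> 1 t\<bar>" using L[OF low[OF t]] True by simp
        have "\<bar>D 2 t \<bullet> \<zeta>\<bar> \<le> norm (D 2 t) * norm \<zeta>" by (rule Cauchy_Schwarz_ineq2)
        also have "\<dots> \<le> M * norm \<zeta>" by (intro mult_right_mono M t) auto
        finally have "\<bar>\<phi> \<zeta> 2 t\<bar> \<le> 2 * pi * M * norm \<zeta>" by (simp add: \<phi>_def abs_mult)
        moreover have "(L \<zeta>)\<^sup>2 \<le> (\<phi> \<zeta> 1 t)\<^sup>2"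
          using low' Lpos[OF \<zeta>] by (metis abs_le_square_iff abs_of_pos)
        ultimately show "\<bar>\<phi> \<zeta> 2 t\<bar> / (\<phi> \<zeta> 1 t)\<^sup>2 \<le> B"
          unfolding B_def using Lpos[OF \<zeta>] \<open>M \<ge> 0\<close> by (intro frac_le) auto
      qed
      also have "\<dots> = A * norm \<zeta> powr (- 1 / real k)"
      proof -
        have "norm \<zeta> > 0" using \<zeta> by linarith
        then show ?thesis
          using \<open>c > 0\<close> True by (simp add: A_def B_def L_def powr_minus_divide field_simps power2_eq_square)
      qed
      also have "\<dots> \<le> A * norm \<zeta> powr (- 1 / real n)"
        using \<open>A \<ge> 0\<close> weaken[OF \<zeta>] by (intro mult_left_mono)
      finally show "norm (integral {a..b} (\<lambda>t. cis (- 2 * pi * (D 0 t \<bullet> \<zeta>)))) \<le> A * norm \<zeta> powr (- 1 / real n)"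
        by (simp add: \<phi>_def)
    qed
  next
    case False
    obtain C :: real where "C > 0" and
      C: "\<And>\<phi> a b L. a \<le> b \<Longrightarrow> L > 0 \<Longrightarrow>
      (\<forall>j\<le>k. \<forall>t\<in>{a..b}. (\<phi> j has_real_derivative \<phi> (Suc j) t) (at t within {a..b})) \<Longrightarrow>
      (\<forall>t\<in>{a..b}. L \<le> \<bar>\<phi> k t\<bar>) \<Longrightarrow>
      (k = 1 \<longrightarrow> (\<forall>t\<in>{a..b}. 0 \<le> \<phi> 2 t) \<or> (\<forall>t\<in>{a..b}. \<phi> 2 t \<le> 0)) \<Longrightarrow>
      norm (integral {a..b} (\<lambda>t. cis (\<phi> 0 t))) \<le> C * L powr (- 1 / real k)"
      using van_der_Corput[OF \<open>1 \<le> k\<close>] by blast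
    define A where "A = C * (2 * pi * c) powr (- 1 / real k)"
    have "A \<ge> 0" using \<open>C > 0\<close> by (simp add: A_def)
    show thesis
    proof (rule that[of A])
      fix \<zeta> :: 'a
      assume \<zeta>: "norm \<zeta> \<ge> 1" and low: "\<And>t. t \<in> {a..b} \<Longrightarrow> c * norm \<zeta> \<le> \<bar>D k t \<bullet> \<zeta>\<bar>"
      have "norm (integral {a..b} (\<lambda>t. cis (\<phi> \<zeta> 0 t))) \<le> C * L \<zeta> powr (- 1 / real k)"
        by (rule C[OF \<open>a \<le> b\<close> Lpos[OF \<zeta>]]) (use False d L[OF low] in auto)
      also have "\<dots> = A * norm \<zeta> powr (- 1 / real k)"
        using \<open>c > 0\<close> by (simp add: A_def L_def powr_mult)
      also have "\<dots> \<le> A * norm \<zeta> powr (- 1 / real n)"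
        using \<open>A \<ge> 0\<close> weaken[OF \<zeta>] by (intro mult_left_mono)
      finally show "norm (integral {a..b} (\<lambda>t. cis (- 2 * pi * (D 0 t \<bullet> \<zeta>)))) \<le> A * norm \<zeta> powr (- 1 / real n)"
        by (simp add: \<phi>_def)
    qed
  qed
qed

text \<open>Which derivative dominates depends on the direction of \<open>\<zeta>\<close>, but only
  finitely many orders occur, so one arc and one constant serve all frequencies. The exponent is
  attained, not merely approached.\<close>

theorem fourier_decay_exponent_nondegenerate_curve:
  fixes \<gamma> :: "real \<Rightarrow> 'a::euclidean_space"
  assumes "DIM('a) \<ge> 2" "interior I \<noteq> {}" "smooth_on I \<gamma>" "nondegenerate_on I \<gamma>"
  shows "2 / DIM('a) \<in> fourier_decay_exponents (\<gamma> ` I)"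
proof -
  let ?n = "DIM('a)"
  define D where "D k = nth_vector_derivative k I \<gamma>" for k
  obtain a r where "r > 0" and I: "cball a r \<subseteq> I"
    using assms(2) by (meson ex_in_conv mem_interior_cball)
  then have aI: "a \<in> I" by auto
  have D: "(D k has_vector_derivative D (Suc k) t) (at t within {s..s'})"
    if "t \<in> {s..s'}" "{s..s'} \<subseteq> cball a r" for k t s s'
    unfolding D_def using I that
    by (intro has_vector_derivative_within_subset[OF nth_vector_derivative_has_vector_derivative[OF assms(3)]]) auto
  obtain c where "c > 0" and c: "\<And>x. \<exists>k\<in>{1..?n}. c * norm x \<le> \<bar>D k a \<bullet> x\<bar>"
    using nondegenerate_family_lower_bound[of "\<lambda>k. D k a"] assms(4) aI
    unfolding nondegenerate_on_def D_def by blast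
  have "\<exists>\<delta>>0. \<delta> \<le> r \<and> (\<forall>t\<in>{a..a+\<delta>}. norm (D k t - D k a) \<le> c / 2)" for k
  proof -
    have sub: "{a..a+r} \<subseteq> cball a r" by (auto simp: dist_real_def)
    have "continuous_on {a..a+r} (D k)"
      by (rule continuous_on_vector_derivative[OF D[OF _ sub]])
    then obtain d where "d > 0" and d: "\<And>t. t \<in> {a..a+r} \<Longrightarrow> dist t a < d \<Longrightarrow> dist (D k t) (D k a) < c / 2"
      unfolding continuous_on_iff using \<open>c > 0\<close> \<open>r > 0\<close>
      by (metis atLeastAtMost_iff half_gt_zero less_add_same_cancel1 less_imp_le order_refl)
    then show ?thesis
      using \<open>r > 0\<close> by (intro exI[of _ "min r (d / 2)"]) (fastforce simp: dist_norm dist_real_def intro: less_imp_le)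
  qed
  then obtain \<delta> where \<delta>: "\<And>k. \<delta> k > 0" "\<And>k. \<delta> k \<le> r"
    "\<And>k t. t \<in> {a..a + \<delta> k} \<Longrightarrow> norm (D k t - D k a) \<le> c / 2"
    by metis
  \<comment> \<open>On \<open>{a..b}\<close> each of the first \<open>DIM('a)\<close> derivatives
    stays within \<open>c / 2\<close> of its value at \<open>a\<close>, so a lower bound with
    \<open>c\<close> at \<open>a\<close> persists with \<open>c / 2\<close> on the whole
    interval.\<close>
  define b where "b = a + Min (\<delta> ` {1..?n})"
  have ne: "\<delta> ` {1..?n} \<noteq> {}" by (simp add: Suc_le_eq)
  have "a < b" unfolding b_def using \<delta>(1) ne by simp
  have b: "b \<le> a + \<delta> k" if "k \<in> {1..?n}" for k using that by (simp add: b_def)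
  have "1 \<in> {1..?n}" by (simp add: Suc_le_eq)
  then have "b \<le> a + r" using b[of 1] \<delta>(2)[of 1] by linarith
  then have sub: "{a..b} \<subseteq> cball a r" by (auto simp: dist_real_def)
  have D': "(D k has_vector_derivative D (Suc k) t) (at t within {a..b})" if "t \<in> {a..b}" for k t
    using D[OF that sub] .
  have low: "c / 2 * norm x \<le> \<bar>D k t \<bullet> x\<bar>"
    if "k \<in> {1..?n}" "c * norm x \<le> \<bar>D k a \<bullet> x\<bar>" "t \<in> {a..b}" for k x t
  proof -
    have "\<bar>(D k t - D k a) \<bullet> x\<bar> \<le> norm (D k t - D k a) * norm x" by (rule Cauchy_Schwarz_ineq2)
    also have "\<dots> \<le> c / 2 * norm x" using b[of k] that by (intro mult_right_mono \<delta>(3)) auto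
    finally show ?thesis using that(2) unfolding inner_diff_left by linarith
  qed
  define J where "J \<zeta> = integral {a..b} (\<lambda>t. cis (- 2 * pi * (D 0 t \<bullet> \<zeta>)))" for \<zeta>
  have "\<exists>A. \<forall>\<zeta>. norm \<zeta> \<ge> 1 \<longrightarrow> c * norm \<zeta> \<le> \<bar>D k a \<bullet> \<zeta>\<bar> \<longrightarrow>
      norm (J \<zeta>) \<le> A * norm \<zeta> powr (- 1 / real ?n)" if k: "k \<in> {1..?n}" for k
  proof -
    obtain A where A: "\<And>\<zeta>. norm \<zeta> \<ge> 1 \<Longrightarrow> (\<And>t. t \<in> {a..b} \<Longrightarrow> c / 2 * norm \<zeta> \<le> \<bar>D k t \<bullet> \<zeta>\<bar>) \<Longrightarrow>
       norm (J \<zeta>) \<le> A * norm \<zeta> powr (- 1 / real ?n)"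
      using arc_fourier_decay[of a b "c / 2" k ?n D] \<open>a < b\<close> \<open>c > 0\<close> k D' unfolding J_def by force
    then show ?thesis using low[OF k] by blast
  qed
  then obtain A where A: "\<And>k \<zeta>. k \<in> {1..?n} \<Longrightarrow> norm \<zeta> \<ge> 1 \<Longrightarrow> c * norm \<zeta> \<le> \<bar>D k a \<bullet> \<zeta>\<bar> \<Longrightarrow>
      norm (J \<zeta>) \<le> A k * norm \<zeta> powr (- 1 / real ?n)"
    by metis
  have "continuous_on {a..b} (D 0)" by (rule continuous_on_vector_derivative[OF D'])
  note \<mu> = fourier_transform_arc_measure[OF \<open>a < b\<close> this]
  define \<mu> where "\<mu> = distr (restrict_space lborel {a..b}) borel (D 0)"
  \<comment> \<open>The sum majorizes \<open>A k\<close> for whichever \<open>k\<close> belongs to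
    \<open>\<zeta>\<close>; the total mass handles frequencies of norm below 1, where the negative
    power is at least 1.\<close>
  define K where "K = measure \<mu> (space \<mu>) + (\<Sum>k=1..?n. \<bar>A k\<bar>)"
  have decay: "norm (fourier_transform \<mu> \<zeta>) \<le> K * norm \<zeta> powr (- 1 / real ?n)" if "\<zeta> \<noteq> 0" for \<zeta>
  proof (cases "norm \<zeta> \<ge> 1")
    case True
    obtain k where k: "k \<in> {1..?n}" "c * norm \<zeta> \<le> \<bar>D k a \<bullet> \<zeta>\<bar>" using c by blast
    have "norm (fourier_transform \<mu> \<zeta>) \<le> A k * norm \<zeta> powr (- 1 / real ?n)"
      using A[OF k(1) True k(2)] \<mu>(5) by (simp add: \<mu>_def J_def)
    also have "\<bar>A k\<bar> \<le> (\<Sum>k=1..?n. \<bar>A k\<bar>)" using k(1) by (intro member_le_sum) auto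
    then have "A k \<le> K" unfolding K_def using measure_nonneg[of \<mu> "space \<mu>"] by linarith
    then have "A k * norm \<zeta> powr (- 1 / real ?n) \<le> K * norm \<zeta> powr (- 1 / real ?n)"
      by (intro mult_right_mono) auto
    finally show ?thesis .
  next
    case False
    have "finite_measure \<mu>" using \<mu>(2) by (simp add: \<mu>_def)
    then have "norm (fourier_transform \<mu> \<zeta>) \<le> measure \<mu> (space \<mu>)"
      by (rule norm_fourier_transform_le)
    also have "\<dots> \<le> K" by (simp add: K_def sum_nonneg)
    also have "K \<le> K * norm \<zeta> powr (- 1 / real ?n)"
    proof -
      have "1 \<le> norm \<zeta> powr (- 1 / real ?n)"
        using False that powr_mono2'[of "- 1 / real ?n" "norm \<zeta>" 1] by simp
      moreover have "K \<ge> 0" by (simp add: K_def sum_nonneg)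
      ultimately show ?thesis using mult_left_mono[of 1 _ K] by simp
    qed
    finally show ?thesis .
  qed
  have "2 / real ?n \<le> real ?n"
  proof -
    have "2 / real ?n \<le> 1" using assms(1) by simp
    then show ?thesis using assms(1) by linarith
  qed
  moreover have "measure_support \<mu> \<subseteq> \<gamma> ` I"
  proof -
    have "D 0 ` {a..b} \<subseteq> \<gamma> ` I" using sub I unfolding D_def by auto
    then show ?thesis using \<mu>(4) unfolding \<mu>_def by (rule order_trans[rotated])
  qed
  ultimately show ?thesis
    unfolding fourier_decay_exponents_def
    using \<mu>(1-3) decay by (auto simp: \<mu>_def[symmetric] intro!: exI[of _ \<mu>] exI[of _ K])
qed

theorem theorem1p6:
  fixes \<gamma> :: "real \<Rightarrow> real ^ 'n" and I :: "real set" and C :: "(real ^ 'n) set"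
  assumes "CARD('n) \<ge> 2"
    and "is_interval I" and "interior I \<noteq> {}"
    and "smooth_on I \<gamma>" and "nondegenerate_on I \<gamma>"
    and "C = \<gamma> ` I"
  shows "fourier_dim C = 2 / real CARD('n)"
proof -
  have dim: "DIM(real ^ 'n) = CARD('n)" by simp
  have max: "2 / real CARD('n) \<in> fourier_decay_exponents C"
    using fourier_decay_exponent_nondegenerate_curve[of I \<gamma>] assms by (simp add: dim)
  moreover have "s \<le> 2 / real CARD('n)" if "s \<in> fourier_decay_exponents C" for s
    using fourier_decay_exponent_curve_le[of I \<gamma> s] assms that by (simp add: dim)
  \<comment> \<open>The supremum is the maximum of a nonempty set, so the default value 0 does not
    arise.\<close>
  ultimately show ?thesis
    unfolding fourier_dim_def using cSup_eq_maximum by auto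
qed

end
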